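(* For every $\eta>0$ there is an admissible strategy $a\in\mathcal A$ (independent of $d$) such that for all integers $d\ge1$, $$\mathbb E[\mathcal T_d(a)]=O\left(d^{2+\eta}\right),$$ i.e. there is a constant $C=C(\eta)$, not depending on $d$, with $\mathbb E[\mathcal T_d(a)]\le C\,d^{2+\eta}$ for all integers $d\ge 1$.
   Context: An admissible strategy is a sequence $a=(a_i)_{i\ge 0}$ with $a_i\in[0,1]$ and $a_0=\tfrac12$; $\mathcal A$ is the set of admissible strategies. Extend $a$ to a signed sequence $(b_i)_{i\in\mathbb Z}$ by $b_i=a_i$ for $i\ge0$ and $b_i=1-a_{-i}$ for $i<0$. Two independent Markov chains $(X_t)_{t\ge0},(Y_t)_{t\ge 0}$ on $\mathbb Z$ start at $X_0=Y_0=0$; each moves from $k$ to $k+1$ with probability $b_k$ and to $k-1$ with probability $1-b_k$. (These are the displacements of two agents from their starting points $-d$ and $d$.) For an integer $d\ge1$ the rendezvous time is $\mathcal T_d(a)=\inf\{t\ge0: X_t=Y_t+2d\}$ (with value $\infty$ if there is no such $t$). *)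

theory Defs
  imports "HOL-Probability.Probability"
begin

definition admissible :: "(nat \<Rightarrow> real) \<Rightarrow> bool" where
  "admissible a \<longleftrightarrow> (\<forall>i. 0 \<le> a i \<and> a i \<le> 1) \<and> a 0 = 1 / 2"

definition signed_extension :: "(nat \<Rightarrow> real) \<Rightarrow> int \<Rightarrow> real" where
  "signed_extension a k = (if 0 \<le> k then a (nat k) else 1 - a (nat (- k)))"

(* bernoulli_pmf clips its parameter to [0,1]; this has no effect when b extends an
   admissible strategy. *)
definition step_pmf :: "(int \<Rightarrow> real) \<Rightarrow> int \<Rightarrow> int pmf" where
  "step_pmf b k = map_pmf (\<lambda>up. if up then k + 1 else k - 1) (bernoulli_pmf (b k))"

(* Law of the position at time n given the positions \<omega> 0, ..., \<omega> (n - 1). *)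
definition walk_kernel :: "(int \<Rightarrow> real) \<Rightarrow> nat \<Rightarrow> (nat \<Rightarrow> int) \<Rightarrow> int measure" where
  "walk_kernel b n \<omega> = measure_pmf (if n = 0 then return_pmf 0 else step_pmf b (\<omega> (n - 1)))"

global_interpretation walk: Ionescu_Tulcea "walk_kernel b" "\<lambda>_. count_space (UNIV :: int set)"
  for b
  defines walk_measure = walk.PF.lim
proof (rule Ionescu_Tulcea.intro)
  show "walk_kernel b i \<in> measurable (PiM {0..<i} (\<lambda>_. count_space UNIV))
      (subprob_algebra (count_space UNIV))" for i
  proof (cases i)
    case 0
    then show ?thesis
      by (simp add: walk_kernel_def[abs_def] measure_pmf_in_subprob_algebra)
  next
    case (Suc j)
    have "(\<lambda>k. measure_pmf (step_pmf b k)) \<circ> (\<lambda>\<omega>. \<omega> j)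
        \<in> measurable (PiM {0..<i} (\<lambda>_. count_space UNIV)) (subprob_algebra (count_space UNIV))"
      by (rule measurable_comp[of _ _ "count_space UNIV"])
        (use Suc in \<open>auto intro!: measurable_component_singleton
            simp: measure_pmf_in_subprob_algebra\<close>)
    with Suc show ?thesis
      by (simp add: walk_kernel_def[abs_def] comp_def)
  qed
next
  show "prob_space (walk_kernel b i x)" for i x
    by (simp add: walk_kernel_def prob_space_measure_pmf)
qed

lemma space_walk_measure [simp]: "space (walk_measure b) = UNIV"
  by (simp add: space_PiM)

lemma sets_walk_measure [measurable_cong]:
  "sets (walk_measure b) = sets (PiM UNIV (\<lambda>_. count_space UNIV))"
  by simp

lemma prob_space_walk_measure: "prob_space (walk_measure b)"
proof (rule prob_space_distrD)
  let ?J = "{} :: nat set"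
  show "(\<lambda>\<omega>. restrict \<omega> ?J) \<in> measurable (walk_measure b) (PiM ?J (\<lambda>_. count_space UNIV))"
    by measurable
  show "prob_space (distr (walk_measure b) (PiM ?J (\<lambda>_. count_space UNIV)) (\<lambda>\<omega>. restrict \<omega> ?J))"
    using walk.distr_lim[of ?J b] walk.PF.prob_space_P[of ?J b] by simp
qed

lemma pmf_step_pmf:
  assumes "0 \<le> b k" "b k \<le> 1"
  shows "pmf (step_pmf b k) l = (if l = k + 1 then b k else if l = k - 1 then 1 - b k else 0)"
proof -
  have "(\<lambda>up. if up then k + 1 else k - 1) -` {l} =
      (if l = k + 1 then {True} else if l = k - 1 then {False} else {})"
    by (auto split: if_splits)
  with assms show ?thesis
    by (simp add: step_pmf_def pmf_map measure_pmf_single)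
qed

lemma restrict_singleton_in_sets:
  fixes n :: nat
  shows "{restrict x {0..<n}} \<in> sets (PiM {0..<n} (\<lambda>_. count_space (UNIV :: int set)))"
proof -
  have "{restrict x {0..<n}} = PiE {0..<n} (\<lambda>i. {x i})"
    by (auto simp: PiE_iff extensional_def restrict_def fun_eq_iff)
  then show ?thesis by (simp add: sets_PiM_I_finite)
qed

lemma emeasure_walk_C:
  "emeasure (walk.C b 0 n (\<lambda>_. undefined)) {restrict x {0..<n}} =
    (\<Prod>i<n. emeasure (walk_kernel b i x) {x i})"
proof (induction n)
  case 0
  show ?case by (auto simp: space_PiM restrict_def PiM_empty)
next
  case (Suc n)
  let ?C = "walk.C b 0 n (\<lambda>_. undefined)"
  let ?M = "\<lambda>n. PiM {0..<n} (\<lambda>_. count_space (UNIV :: int set))"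
  have undef: "(\<lambda>_. undefined) \<in> space (?M 0)" by (simp add: space_PiM PiE_iff extensional_def)
  have sp: "space ?C = space (?M n)" using walk.space_C[OF undef] by simp
  have st: "sets ?C = sets (?M n)" using walk.sets_C[OF undef] by simp
  have ker: "emeasure (walk.eP b n \<omega>) {restrict x {0..<Suc n}} =
      indicator {restrict x {0..<n}} \<omega> * emeasure (walk_kernel b n x) {x n}"
    if \<omega>: "\<omega> \<in> space (?M n)" for \<omega>
  proof -
    have extens: "\<omega> \<in> extensional {0..<n}" using \<omega> by (simp add: space_PiM PiE_def)
    have "(\<lambda>y. fun_upd \<omega> n y) -` {restrict x {0..<Suc n}} =
        (if \<omega> = restrict x {0..<n} then {x n} else {})"
    proof (cases "\<omega> = restrict x {0..<n}")
      case True
      then show ?thesis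
        by (auto simp: fun_eq_iff restrict_def split: if_splits) (meson less_SucI)
    next
      case False
      then obtain i where "\<omega> i \<noteq> restrict x {0..<n} i" by (meson ext)
      moreover from this extens have "i < n"
        by (cases "i < n") (auto simp: extensional_def)
      ultimately have "fun_upd \<omega> n y i \<noteq> restrict x {0..<Suc n} i" for y by auto
      then have "fun_upd \<omega> n y \<noteq> restrict x {0..<Suc n}" for y by metis
      with False show ?thesis by auto
    qed
    moreover have "walk_kernel b n \<omega> = walk_kernel b n x" if "\<omega> = restrict x {0..<n}"
      using that by (auto simp: walk_kernel_def)
    ultimately show ?thesis
      by (simp add: walk.emeasure_eP[OF \<omega> restrict_singleton_in_sets])
  qed
  have "emeasure (walk.C b 0 (Suc n) (\<lambda>_. undefined)) {restrict x {0..<Suc n}} =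
      (\<integral>\<^sup>+ \<omega>. emeasure (walk.eP b n \<omega>) {restrict x {0..<Suc n}} \<partial>?C)"
    using emeasure_bind[of ?C "walk.eP b n" "?M (Suc n)" "{restrict x {0..<Suc n}}"]
      walk.prob_space_C[OF undef, THEN prob_space.not_empty, of b n]
      walk.measurable_eP[of b n] restrict_singleton_in_sets[of x "Suc n"]
    by (simp add: measurable_cong_sets[OF st refl])
  also have "\<dots> = (\<integral>\<^sup>+ \<omega>. indicator {restrict x {0..<n}} \<omega> *
      emeasure (walk_kernel b n x) {x n} \<partial>?C)"
    by (intro nn_integral_cong ker) (simp add: sp)
  also have "\<dots> = emeasure ?C {restrict x {0..<n}} * emeasure (walk_kernel b n x) {x n}"
  proof -
    have "{restrict x {0..<n}} \<in> sets ?C"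
      unfolding st by (rule restrict_singleton_in_sets)
    then show ?thesis by (subst nn_integral_multc) auto
  qed
  finally show ?case by (simp only: Suc.IH prod.lessThan_Suc)
qed

text \<open>Under \<^term>\<open>walk_measure b\<close> the coordinate process is the Markov chain started at 0
  with transition probabilities \<^term>\<open>pmf (step_pmf b k) l\<close>.\<close>

lemma walk_measure_cylinder:
  "measure (walk_measure b) {\<omega>. \<forall>i\<le>n. \<omega> i = x i} =
    of_bool (x 0 = 0) * (\<Prod>i<n. pmf (step_pmf b (x i)) (x (Suc i)))"
proof -
  let ?J = "{0..<Suc n}"
  have "{\<omega>. \<forall>i\<le>n. \<omega> i = x i} = walk.PF.emb UNIV ?J {restrict x ?J}"
    by (auto simp: prod_emb_def fun_eq_iff restrict_def less_Suc_eq_le)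
      (metis)
  then have "emeasure (walk_measure b) {\<omega>. \<forall>i\<le>n. \<omega> i = x i} =
      emeasure (walk.CI b ?J) {restrict x ?J}"
    using walk.lim[of ?J "{restrict x ?J}" b] restrict_singleton_in_sets[of x "Suc n"] by simp
  also have "\<dots> = emeasure (walk.C b 0 (Suc n) (\<lambda>_. undefined)) {restrict x ?J}"
  proof -
    have "walk.PF.emb ?J ?J {restrict x ?J} = {restrict x ?J}"
      by (rule prod_emb_id) (auto simp: restrict_def)
    then show ?thesis
      using walk.emeasure_CI[of ?J "Suc n" "{restrict x ?J}" b]
        restrict_singleton_in_sets[of x "Suc n"] by simp
  qed
  also have "\<dots> = (\<Prod>i<Suc n. emeasure (walk_kernel b i x) {x i})"
    by (rule emeasure_walk_C)
  also have "\<dots> = ennreal (of_bool (x 0 = 0) * (\<Prod>i<n. pmf (step_pmf b (x i)) (x (Suc i))))"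
    by (subst prod.lessThan_Suc_shift)
      (simp add: walk_kernel_def emeasure_pmf_single prod_ennreal ennreal_mult' prod_nonneg
        indicator_def del: prod.lessThan_Suc)
  finally show ?thesis
    by (simp add: measure_def prod_nonneg)
qed

definition rendezvous_time :: "nat \<Rightarrow> (nat \<Rightarrow> int) \<times> (nat \<Rightarrow> int) \<Rightarrow> enat" where
  "rendezvous_time d = (\<lambda>(x, y). Inf {enat t | t. x t = y t + 2 * int d})"

lemma measurable_rendezvous_time [measurable]:
  "rendezvous_time d \<in> measurable (walk_measure b \<Otimes>\<^sub>M walk_measure b') (count_space UNIV)"
proof -
  have coord: "(\<lambda>\<omega>. \<omega> t) \<in> measurable (walk_measure b) (count_space UNIV)" for t b
    by measurable
  have [measurable]: "{p \<in> space (walk_measure b \<Otimes>\<^sub>M walk_measure b').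
      fst p t = snd p t + 2 * int d} \<in> sets (walk_measure b \<Otimes>\<^sub>M walk_measure b')" for t
  proof -
    have "(\<lambda>p. fst p t) \<in> measurable (walk_measure b \<Otimes>\<^sub>M walk_measure b') (count_space UNIV)"
      using measurable_compose[OF measurable_fst coord] .
    moreover have "(\<lambda>p. snd p t) \<in> measurable (walk_measure b \<Otimes>\<^sub>M walk_measure b') (count_space UNIV)"
      using measurable_compose[OF measurable_snd coord] .
    ultimately show ?thesis by measurable
  qed
  have *: "rendezvous_time d =
      (\<lambda>p. INF t. if fst p t = snd p t + 2 * int d then enat t else \<infinity>)"
  proof
    fix p
    show "rendezvous_time d p =
        (INF t. if fst p t = snd p t + 2 * int d then enat t else \<infinity>)"
    proof (rule antisym)
      show "rendezvous_time d p \<le>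
          (INF t. if fst p t = snd p t + 2 * int d then enat t else \<infinity>)"
        by (rule INF_greatest) (auto simp: rendezvous_time_def case_prod_unfold intro: Inf_lower)
      show "(INF t. if fst p t = snd p t + 2 * int d then enat t else \<infinity>) \<le>
          rendezvous_time d p"
        unfolding rendezvous_time_def case_prod_unfold
      proof (rule Inf_greatest, clarify)
        fix t assume "fst p t = snd p t + 2 * int d"
        then show "(INF t. if fst p t = snd p t + 2 * int d then enat t else \<infinity>) \<le> enat t"
          using INF_lower[of t UNIV "\<lambda>t. if fst p t = snd p t + 2 * int d then enat t else \<infinity>"]
          by simp
      qed
    qed
  qed
  show ?thesis unfolding * by measurable
qed

text \<open>The product measure makes the two walks independent.\<close>

definition expected_rendezvous_time :: "nat \<Rightarrow> (nat \<Rightarrow> real) \<Rightarrow> ennreal" where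
  "expected_rendezvous_time d a =
    (let W = walk_measure (signed_extension a)
     in \<integral>\<^sup>+ \<omega>. ennreal_of_enat (rendezvous_time d \<omega>) \<partial>(W \<Otimes>\<^sub>M W))"

end

theory Submission
  imports Defs
begin

text \<open>
  For \<open>\<epsilon> \<le> 1\<close> the strategy is chosen so that the distance of one agent from its start needs
  expected time \<open>64 / \<epsilon> * k powr (1 + \<epsilon>)\<close> to pass from \<open>k\<close> to \<open>k + 1\<close>, while the pair of agents
  returns from \<open>(x, y)\<close> to \<open>(0, 0)\<close> in expected time of order \<open>x\<^sup>2 + y\<^sup>2\<close>. Hence one of the agents
  reaches distance \<open>2 d\<close> within expected time of order \<open>d powr (2 + \<epsilon>)\<close>. By symmetry the signs of the
  two displacements are then fair coins, so the agents meet by that time with probability at least 1/4;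
  otherwise they return to \<open>(0, 0)\<close> in time of order \<open>d\<^sup>2\<close> and start afresh. To avoid
  stopping times, this is carried out for the expectation \<open>M n\<close> of the rendezvous time truncated
  at \<open>n\<close>, for which it gives \<open>M n \<le> 3 / 4 * M n + K\<close>.
\<close>

section \<open>Lyapunov bounds for the truncated rendezvous time\<close>

definition step_mean :: "(int \<Rightarrow> real) \<Rightarrow> (int \<Rightarrow> real) \<Rightarrow> int \<Rightarrow> real" where
  "step_mean b g x = b x * g (x + 1) + (1 - b x) * g (x - 1)"

text \<open>The mean of \<open>min T n\<close> for the walks started at \<open>x\<close> and \<open>y\<close>, where \<open>T\<close> is the first time that
  \<open>x - y \<ge> L\<close>. Nearest-neighbour walks with \<open>L - (x - y)\<close> even and nonnegative cannot jump over \<open>L\<close>,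
  so this is the rendezvous time when \<open>L = 2 d\<close>.\<close>

primrec truncated_mean :: "(int \<Rightarrow> real) \<Rightarrow> int \<Rightarrow> nat \<Rightarrow> int \<Rightarrow> int \<Rightarrow> real" where
  "truncated_mean b L 0 x y = 0"
| "truncated_mean b L (Suc n) x y =
    (if L \<le> x - y then 0
     else 1 + step_mean b (\<lambda>k. step_mean b (truncated_mean b L n k) y) x)"

declare truncated_mean.simps(2) [simp del]

locale walk_prob =
  fixes b :: "int \<Rightarrow> real"
  assumes prob_nonneg: "0 \<le> b x" and prob_le_1: "b x \<le> 1"
begin

lemma step_mean_mono: "(\<And>k. g k \<le> g' k) \<Longrightarrow> step_mean b g x \<le> step_mean b g' x"
  unfolding step_mean_def
  by (intro add_mono mult_left_mono) (use prob_nonneg[of x] prob_le_1[of x] in auto)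

text \<open>The bounds compared later hold only at states of one parity or within distance
  \<open>L\<close>, so domination is available at the two neighbours alone.\<close>

lemma step_mean_nearest_mono:
  "g (x + 1) \<le> g' (x + 1) \<Longrightarrow> g (x - 1) \<le> g' (x - 1) \<Longrightarrow> step_mean b g x \<le> step_mean b g' x"
  unfolding step_mean_def
  by (intro add_mono mult_left_mono) (use prob_nonneg[of x] prob_le_1[of x] in auto)

lemma step_mean_const [simp]: "step_mean b (\<lambda>_. c) x = c"
  by (simp add: step_mean_def algebra_simps)

lemma step_mean_add: "step_mean b (\<lambda>k. g k + g' k) x = step_mean b g x + step_mean b g' x"
  by (simp add: step_mean_def algebra_simps)

lemma step_mean_diff: "step_mean b (\<lambda>k. g k - g' k) x = step_mean b g x - step_mean b g' x"
  by (simp add: step_mean_def algebra_simps)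

lemma step_mean_cmult: "step_mean b (\<lambda>k. c * g k) x = c * step_mean b g x"
  by (simp add: step_mean_def algebra_simps)

lemma step_mean_divide: "step_mean b (\<lambda>k. g k / c) x = step_mean b g x / c"
  by (simp add: step_mean_def add_divide_distrib)

lemma truncated_mean_nonneg: "0 \<le> truncated_mean b L n x y"
proof (induction n arbitrary: x y)
  case (Suc n)
  have "step_mean b (\<lambda>_. 0) x \<le> step_mean b (\<lambda>k. step_mean b (truncated_mean b L n k) y) x"
    using step_mean_mono[of "\<lambda>_. 0" "truncated_mean b L n _" y] Suc
    by (intro step_mean_mono) auto
  then show ?case by (simp add: truncated_mean.simps(2))
qed simp

lemma truncated_mean_Suc_ge: "truncated_mean b L n x y \<le> truncated_mean b L (Suc n) x y"
proof (induction n arbitrary: x y)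
  case 0
  show ?case using truncated_mean_nonneg[of L "Suc 0" x y] by simp
next
  case (Suc n)
  have "step_mean b (\<lambda>k. step_mean b (truncated_mean b L n k) y) x
      \<le> step_mean b (\<lambda>k. step_mean b (truncated_mean b L (Suc n) k) y) x"
    by (intro step_mean_mono Suc)
  then show ?case
    unfolding truncated_mean.simps(2)[of _ _ "Suc n"] truncated_mean.simps(2)[of _ _ n x] by simp
qed

lemma truncated_mean_mono: "m \<le> n \<Longrightarrow> truncated_mean b L m x y \<le> truncated_mean b L n x y"
  by (rule lift_Suc_mono_le[of "\<lambda>n. truncated_mean b L n x y"]) (auto intro: truncated_mean_Suc_ge)

lemma truncated_mean_Suc_le:
  "truncated_mean b L (Suc n) x y \<le> 1 + step_mean b (\<lambda>k. step_mean b (truncated_mean b L n k) y) x"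
proof -
  have "0 \<le> step_mean b (\<lambda>k. step_mean b (truncated_mean b L n k) y) x"
    using step_mean_mono[of "\<lambda>_. 0" "\<lambda>k. step_mean b (truncated_mean b L n k) y" x]
      step_mean_mono[of "\<lambda>_. 0" "truncated_mean b L n _" y] truncated_mean_nonneg by auto
  then show ?thesis by (simp add: truncated_mean.simps(2))
qed

end

lemma step_mean_reflect:
  assumes "\<And>x. b (- x) = 1 - b x"
  shows "step_mean b g (- x) = step_mean b (\<lambda>k. g (- k)) x"
proof -
  have "- x + 1 = - (x - 1)" "- x - 1 = - (x + 1)" by simp_all
  then show ?thesis unfolding step_mean_def assms by (simp only:) simp
qed

text \<open>Only states with \<open>x + y\<close> even are reachable, which excludes \<open>(0, \<plusminus>1)\<close>, where no \<open>h\<close> could have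
  the required drift.\<close>

locale symmetric_walk_lyapunov = walk_prob +
  fixes f h :: "int \<Rightarrow> real" and c :: real
  assumes prob_reflect: "b (- x) = 1 - b x"
    and f_zero: "f 0 = 0" and f_drift: "f x + 1 \<le> step_mean b f x"
    and h_zero: "h 0 = 0" and h_nonneg: "0 \<le> h x"
    and c_pos: "0 < c"
    and h_drift: "even (x + y) \<Longrightarrow> (x, y) \<noteq> (0, 0) \<Longrightarrow>
      step_mean b h x + step_mean b h y \<le> h x + h y - c"
begin

text \<open>By the drift condition \<open>(h x + h y) / c\<close> bounds the expected time to return
  to the origin, the fall of the potential paying for each step. At the origin at most
  \<open>n\<close> steps are left, and \<open>truncated_mean\<close> increases with the
  horizon.\<close>

lemma truncated_mean_le_return:
  assumes "m \<le> n" "even (x + y)"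
  shows "truncated_mean b L m x y \<le> truncated_mean b L n 0 0 + (h x + h y) / c"
  using assms
proof (induction m arbitrary: x y)
  case 0
  have "0 \<le> (h x + h y) / c"
    using c_pos h_nonneg[of x] h_nonneg[of y] by simp
  then show ?case using truncated_mean_nonneg[of L n 0 0] by simp
next
  case (Suc m)
  let ?M = "truncated_mean b L n 0 0"
  show ?case
  proof (cases "(x, y) = (0, 0)")
    case True
    then show ?thesis
      using truncated_mean_mono[OF Suc.prems(1), of L 0 0] h_zero by simp
  next
    case False
    have IH: "truncated_mean b L m k l \<le> ?M + (h k + h l) / c" if "even (k + l)" for k l
      using Suc that by simp
    \<comment> \<open>With only the first coordinate moved, \<open>k + y\<close> is odd; moving the
      second restores the even parity that the induction hypothesis needs.\<close>
    have inner: "step_mean b (truncated_mean b L m k) y \<le> ?M + (h k + step_mean b h y) / c"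
      if "odd (k + y)" for k
    proof -
      have "step_mean b (truncated_mean b L m k) y \<le> step_mean b (\<lambda>l. ?M + (h k + h l) / c) y"
        using that by (intro step_mean_nearest_mono IH) auto
      also have "\<dots> = ?M + (h k + step_mean b h y) / c"
        by (simp add: step_mean_add step_mean_divide)
      finally show ?thesis .
    qed
    have "step_mean b (\<lambda>k. step_mean b (truncated_mean b L m k) y) x
        \<le> step_mean b (\<lambda>k. ?M + (h k + step_mean b h y) / c) x"
      using Suc.prems by (intro step_mean_nearest_mono inner) auto
    also have "\<dots> = ?M + (step_mean b h x + step_mean b h y) / c"
      by (simp add: step_mean_add step_mean_divide)
    also have "\<dots> \<le> ?M + (h x + h y - c) / c"
      using h_drift[OF Suc.prems(2) False] c_pos by (simp add: divide_right_mono)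
    also have "\<dots> = ?M + (h x + h y) / c - 1"
      using c_pos by (simp add: diff_divide_distrib)
    finally show ?thesis
      using truncated_mean_Suc_le[of L m x y] by linarith
  qed
qed

section \<open>Averaging over the signs of the two displacements\<close>

definition sign_sum :: "int \<Rightarrow> nat \<Rightarrow> int \<Rightarrow> int \<Rightarrow> real" where
  "sign_sum L n x y = truncated_mean b L n x y + truncated_mean b L n (- x) y +
     truncated_mean b L n x (- y) + truncated_mean b L n (- x) (- y)"

text \<open>By reflection the averages at \<open>- x\<close> and \<open>- y\<close> become averages
  at \<open>x\<close> and \<open>y\<close>, so the four sign choices evolve together. Each of them
  contributes 1 to the constant 4.\<close>

lemma sign_sum_Suc_le:
  "sign_sum L (Suc n) x y \<le> 4 + step_mean b (\<lambda>k. step_mean b (sign_sum L n k) y) x"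
proof -
  have "step_mean b (\<lambda>k. step_mean b (sign_sum L n k) y) x =
      step_mean b (\<lambda>k. step_mean b (truncated_mean b L n k) y) x +
      step_mean b (\<lambda>k. step_mean b (truncated_mean b L n k) y) (- x) +
      step_mean b (\<lambda>k. step_mean b (truncated_mean b L n k) (- y)) x +
      step_mean b (\<lambda>k. step_mean b (truncated_mean b L n k) (- y)) (- x)"
    by (simp add: sign_sum_def[abs_def] step_mean_add step_mean_reflect[of b, OF prob_reflect])
  with truncated_mean_Suc_le[of L n x y] truncated_mean_Suc_le[of L n "- x" y]
    truncated_mean_Suc_le[of L n x "- y"] truncated_mean_Suc_le[of L n "- x" "- y"]
  show ?thesis unfolding sign_sum_def by linarith
qed

text \<open>While both distances are below \<open>L\<close>, a step costs 4, which the drift of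
  \<open>f\<close> in the first coordinate pays out of \<open>4 * (B - f x)\<close>. Once a distance
  equals \<open>L\<close>, one of the four sign choices is already stopped, and the other three are
  bounded through a return to the origin.\<close>

lemma sign_sum_le:
  assumes f_le: "\<And>x. \<bar>x\<bar> \<le> L \<Longrightarrow> f x \<le> B"
    and h_le: "\<And>x. \<bar>x\<bar> \<le> L \<Longrightarrow> h x \<le> H"
    and "m \<le> n" "\<bar>x\<bar> \<le> L" "\<bar>y\<bar> \<le> L" "even (x + y)"
  shows "sign_sum L m x y \<le> 3 * truncated_mean b L n 0 0 + 6 * H / c + 4 * (B - f x)"
  using assms(3-)
proof (induction m arbitrary: x y)
  case 0
  have "0 \<le> H" using h_le[of x] h_nonneg[of x] 0 by linarith
  then have "0 \<le> 6 * H / c" using c_pos by simp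
  with f_le[of x] 0 truncated_mean_nonneg[of L n 0 0]
  show ?case by (simp add: sign_sum_def)
next
  case (Suc m)
  let ?M = "truncated_mean b L n 0 0"
  let ?R = "3 * ?M + 6 * H / c"
  show ?case
  proof (cases "\<bar>x\<bar> = L \<or> \<bar>y\<bar> = L")
    case True
    define Q where "Q = ?M + 2 * H / c"
    have le: "truncated_mean b L (Suc m) u v \<le> Q"
      if "\<bar>u\<bar> = \<bar>x\<bar>" "\<bar>v\<bar> = \<bar>y\<bar>" for u v
    proof -
      have "even (u + v)" using that Suc.prems(4) by (auto simp: abs_if split: if_splits)
      then have "truncated_mean b L (Suc m) u v \<le> ?M + (h u + h v) / c"
        by (intro truncated_mean_le_return Suc.prems)
      moreover have "(h u + h v) / c \<le> 2 * H / c"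
        using h_le[of u] h_le[of v] that Suc.prems c_pos by (intro divide_right_mono) auto
      ultimately show ?thesis by (simp add: Q_def)
    qed
    \<comment> \<open>Here the difference of the positions is
      \<open>\<bar>x\<bar> + \<bar>y\<bar>\<close>, which is at least \<open>L\<close>.\<close>
    have hit: "truncated_mean b L (Suc m) \<bar>x\<bar> (- \<bar>y\<bar>) = 0"
      using True by (auto simp: truncated_mean.simps(2))
    have "sign_sum L (Suc m) x y \<le> 3 * Q"
    proof -
      have les: "truncated_mean b L (Suc m) x y \<le> Q"
        "truncated_mean b L (Suc m) (- x) y \<le> Q"
        "truncated_mean b L (Suc m) x (- y) \<le> Q"
        "truncated_mean b L (Suc m) (- x) (- y) \<le> Q"
        by (rule le; simp)+
      from hit have "truncated_mean b L (Suc m) x y = 0 \<or> truncated_mean b L (Suc m) (- x) y = 0 \<or>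
          truncated_mean b L (Suc m) x (- y) = 0 \<or> truncated_mean b L (Suc m) (- x) (- y) = 0"
        by (auto simp: abs_if split: if_splits)
      with les show ?thesis unfolding sign_sum_def by (elim disjE) linarith+
    qed
    also have "\<dots> = ?R" by (simp add: Q_def)
    also have "\<dots> \<le> ?R + 4 * (B - f x)" using f_le[of x] Suc.prems by simp
    finally show ?thesis .
  next
    case False
    have IH: "sign_sum L m k l \<le> ?R + 4 * (B - f k)"
      if "\<bar>k - x\<bar> = 1" "\<bar>l - y\<bar> = 1" for k l
    proof (rule Suc.IH)
      show "even (k + l)" using that Suc.prems(4) by presburger
    qed (use that Suc.prems False in auto)
    have inner: "step_mean b (sign_sum L m k) y \<le> ?R + 4 * (B - f k)" if "\<bar>k - x\<bar> = 1" for k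
      using step_mean_nearest_mono[of "sign_sum L m k" y "\<lambda>_. ?R + 4 * (B - f k)"] IH[OF that]
      by simp
    have "step_mean b (\<lambda>k. step_mean b (sign_sum L m k) y) x
        \<le> step_mean b (\<lambda>k. ?R + 4 * (B - f k)) x"
      by (intro step_mean_nearest_mono inner) auto
    also have "\<dots> = ?R + 4 * (B - step_mean b f x)"
      by (simp add: step_mean_add step_mean_cmult step_mean_diff)
    also have "\<dots> \<le> ?R + 4 * (B - (f x + 1))" using f_drift[of x] by simp
    finally show ?thesis
      using sign_sum_Suc_le[of L m x y] by (simp add: algebra_simps)
  qed
qed

text \<open>At the origin the four sign choices coincide, so \<open>sign_sum_le\<close> with
  \<open>m = n\<close> reads \<open>4 * M \<le> 3 * M + 6 * H / c + 4 * B\<close> for the truncated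
  mean \<open>M\<close>. Truncation makes \<open>M\<close> a real number, which can be
  cancelled.\<close>

lemma truncated_mean_le:
  assumes "\<And>x. \<bar>x\<bar> \<le> L \<Longrightarrow> f x \<le> B" "\<And>x. \<bar>x\<bar> \<le> L \<Longrightarrow> h x \<le> H" "0 \<le> L"
  shows "truncated_mean b L n 0 0 \<le> 6 * H / c + 4 * B"
proof -
  have "sign_sum L n 0 0 \<le> 3 * truncated_mean b L n 0 0 + 6 * H / c + 4 * (B - f 0)"
    using assms by (intro sign_sum_le) auto
  then show ?thesis by (simp add: sign_sum_def f_zero)
qed

end

section \<open>The Markov property of the two walks\<close>

text \<open>A finite product of countable discrete spaces is discrete, so functions of finitely many
  positions are automatically measurable.\<close>

lemma PiM_int_eq_count_space:
  "PiM {0..<n::nat} (\<lambda>_. count_space (UNIV :: int set)) = count_space (extensional {0..<n})"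
  by (simp add: count_space_PiM_finite PiE_UNIV_domain PiE_def)

lemma measurable_walk_restrict [measurable]:
  "(\<lambda>\<omega>. restrict \<omega> {0..<n}) \<in> measurable (walk_measure b) (count_space (extensional {0..<n}))"
  unfolding PiM_int_eq_count_space[symmetric] by measurable

text \<open>Identifies the finite-step law \<open>walk.C\<close> of the Ionescu-Tulcea construction
  with the distribution of the first \<open>n\<close> positions. \<open>F\<close> can be arbitrary
  because that space is discrete.\<close>

lemma nn_integral_walk_restrict:
  "(\<integral>\<^sup>+ \<omega>. F (restrict \<omega> {0..<n}) \<partial>walk_measure b) =
    (\<integral>\<^sup>+ \<omega>. F \<omega> \<partial>walk.C b 0 n (\<lambda>_. undefined))"
proof -
  let ?M = "PiM {0..<n} (\<lambda>_. count_space (UNIV :: int set))"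
  have C: "walk.C b 0 n (\<lambda>_. undefined) = walk.CI b {0..<n}"
  proof (rule measure_eqI)
    show "sets (walk.C b 0 n (\<lambda>_. undefined)) = sets (walk.CI b {0..<n})"
      by (simp add: walk.sets_C walk.CI_def)
    fix X assume "X \<in> sets (walk.C b 0 n (\<lambda>_. undefined))"
    then have X: "X \<in> sets ?M" by (simp add: walk.sets_C)
    then have "walk.PF.emb {0..<n} {0..<n} X = X"
      using sets.sets_into_space[OF X] by (intro prod_emb_id) (auto simp: space_PiM)
    with walk.emeasure_CI[of "{0..<n}" n X b] X
    show "emeasure (walk.C b 0 n (\<lambda>_. undefined)) X = emeasure (walk.CI b {0..<n}) X" by simp
  qed
  have "(\<integral>\<^sup>+ \<omega>. F \<omega> \<partial>walk.CI b {0..<n}) =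
      (\<integral>\<^sup>+ \<omega>. F \<omega> \<partial>distr (walk_measure b) ?M (\<lambda>\<omega>. restrict \<omega> {0..<n}))"
    by (simp add: walk.distr_lim)
  also have "\<dots> = (\<integral>\<^sup>+ \<omega>. F (restrict \<omega> {0..<n}) \<partial>walk_measure b)"
    by (rule nn_integral_distr) (simp_all add: PiM_int_eq_count_space)
  finally show ?thesis by (simp add: C)
qed

text \<open>The Markov property, with the whole past kept in the integrand: each
  \<open>walk.C\<close> is the bind of the previous one with a kernel that reads only the last
  position.\<close>

lemma nn_integral_walk_Suc:
  "(\<integral>\<^sup>+ \<omega>. F (restrict \<omega> {0..<Suc n}) (\<omega> (Suc n)) \<partial>walk_measure b) =
    (\<integral>\<^sup>+ \<omega>. (\<integral>\<^sup>+ k. F (restrict \<omega> {0..<Suc n}) k \<partial>step_pmf b (\<omega> n)) \<partial>walk_measure b)"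
proof -
  let ?n = "Suc n"
  let ?C = "walk.C b 0 ?n (\<lambda>_. undefined)"
  let ?M = "\<lambda>n. PiM {0..<n} (\<lambda>_. count_space (UNIV :: int set))"
  let ?F = "\<lambda>\<omega>. F (restrict \<omega> {0..<?n}) (\<omega> ?n)"
  have undef: "(\<lambda>_. undefined) \<in> space (?M 0)"
    by (simp add: space_PiM PiE_iff extensional_def)
  have sp: "space ?C = extensional {0..<?n}"
    using walk.space_C[OF undef, of b ?n] by (simp add: PiM_int_eq_count_space)
  have "(\<integral>\<^sup>+ \<omega>. ?F \<omega> \<partial>walk_measure b) = (\<integral>\<^sup>+ \<omega>. ?F (restrict \<omega> {0..<Suc ?n}) \<partial>walk_measure b)"
    by (intro nn_integral_cong arg_cong2[where f=F]) (auto simp: fun_eq_iff)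
  also have "\<dots> = (\<integral>\<^sup>+ \<omega>. ?F \<omega> \<partial>walk.C b 0 (Suc ?n) (\<lambda>_. undefined))"
    by (rule nn_integral_walk_restrict)
  also have "\<dots> = (\<integral>\<^sup>+ \<omega>. (\<integral>\<^sup>+ \<omega>'. ?F \<omega>' \<partial>walk.eP b ?n \<omega>) \<partial>?C)"
    unfolding walk.C.simps(2)[of b 0 ?n] add_0
  proof (rule nn_integral_bind)
    show "?F \<in> borel_measurable (?M (Suc ?n))" by (simp add: PiM_int_eq_count_space)
    show "walk.eP b ?n \<in> measurable ?C (subprob_algebra (?M (Suc ?n)))"
      unfolding measurable_cong_sets[OF walk.sets_C[OF undef, of b ?n] refl] add_0
      by (rule walk.measurable_eP)
  qed
  also have "\<dots> = (\<integral>\<^sup>+ \<omega>. (\<integral>\<^sup>+ k. F (restrict \<omega> {0..<?n}) k \<partial>step_pmf b (\<omega> n)) \<partial>?C)"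
  proof (rule nn_integral_cong)
    fix \<omega> assume "\<omega> \<in> space ?C"
    then have \<omega>: "\<omega> \<in> space (?M ?n)" by (simp only: sp PiM_int_eq_count_space space_count_space)
    have "(\<integral>\<^sup>+ \<omega>'. ?F \<omega>' \<partial>walk.eP b ?n \<omega>) =
        (\<integral>\<^sup>+ k. ?F (fun_upd \<omega> ?n k) \<partial>walk_kernel b ?n \<omega>)"
      by (rule walk.nn_integral_eP[OF \<omega>]) (simp add: PiM_int_eq_count_space)
    also have "\<dots> = (\<integral>\<^sup>+ k. F (restrict \<omega> {0..<?n}) k \<partial>step_pmf b (\<omega> n))"
    proof -
      have "restrict (fun_upd \<omega> ?n k) {0..<?n} = restrict \<omega> {0..<?n}" for k
        by (auto simp: fun_eq_iff)
      then show ?thesis by (simp add: walk_kernel_def)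
    qed
    finally show "(\<integral>\<^sup>+ \<omega>'. ?F \<omega>' \<partial>walk.eP b ?n \<omega>) =
        (\<integral>\<^sup>+ k. F (restrict \<omega> {0..<?n}) k \<partial>step_pmf b (\<omega> n))" .
  qed
  also have "\<dots> = (\<integral>\<^sup>+ \<omega>. (\<integral>\<^sup>+ k. F (restrict \<omega> {0..<?n}) k \<partial>step_pmf b (\<omega> n)) \<partial>walk_measure b)"
    using nn_integral_walk_restrict[where n = ?n
        and F = "\<lambda>\<omega>. \<integral>\<^sup>+ k. F (restrict \<omega> {0..<?n}) k \<partial>step_pmf b (\<omega> n)"]
    by simp
  finally show ?thesis .
qed

lemma AE_walk_nearest_neighbour:
  "AE \<omega> in walk_measure b. \<omega> 0 = 0 \<and> (\<forall>n. \<bar>\<omega> (Suc n) - \<omega> n\<bar> = 1)"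
proof -
  interpret prob_space "walk_measure b" by (rule prob_space_walk_measure)
  have coord [measurable]: "(\<lambda>\<omega>. \<omega> t) \<in> measurable (walk_measure b) (count_space UNIV)" for t
    by measurable
  have "prob {\<omega>. \<omega> 0 = 0} = 1"
    using walk_measure_cylinder[of b 0 "\<lambda>_. 0"] by simp
  then have "AE \<omega> in walk_measure b. \<omega> 0 = 0"
    using AE_prob_1[of "{\<omega>. \<omega> 0 = 0}"] by simp
  moreover have "AE \<omega> in walk_measure b. \<bar>\<omega> (Suc n) - \<omega> n\<bar> = 1" for n
  proof -
    \<comment> \<open>The indicator of a wrong jump has integral 0 once the next position is
      averaged out, as \<open>step_pmf\<close> charges only the two neighbours.\<close>
    let ?N = "\<lambda>(\<omega> :: nat \<Rightarrow> int) k. indicator {k. \<bar>k - \<omega> n\<bar> \<noteq> 1} k :: ennreal"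
    have "(\<integral>\<^sup>+ \<omega>. ?N \<omega> (\<omega> (Suc n)) \<partial>walk_measure b) =
        (\<integral>\<^sup>+ \<omega>. (\<integral>\<^sup>+ k. ?N \<omega> k \<partial>step_pmf b (\<omega> n)) \<partial>walk_measure b)"
      using nn_integral_walk_Suc[where F = ?N and n = n] by simp
    also have "\<dots> = 0"
      by (simp add: step_pmf_def nn_integral_0_iff_AE AE_measure_pmf_iff)
    finally have "AE \<omega> in walk_measure b. ?N \<omega> (\<omega> (Suc n)) = 0"
      using measurable_compose[OF measurable_walk_restrict[of "Suc (Suc n)"],
          of "\<lambda>\<omega>. ?N \<omega> (\<omega> (Suc n))" borel b]
      by (subst (asm) nn_integral_0_iff_AE) simp_all
    then show ?thesis by eventually_elim (auto simp: indicator_def split: if_splits)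
  qed
  ultimately show ?thesis by (simp add: AE_all_countable)
qed

section \<open>Tail sums of the first passage time of the pair\<close>

definition apart :: "int \<Rightarrow> nat \<Rightarrow> (nat \<Rightarrow> int) \<Rightarrow> (nat \<Rightarrow> int) \<Rightarrow> bool" where
  "apart L t \<omega> \<omega>' \<longleftrightarrow> (\<forall>s\<le>t. \<omega> s - \<omega>' s < L)"

lemma apart_restrict [simp]:
  "apart L t (restrict \<omega> {0..<Suc t}) \<omega>' = apart L t \<omega> \<omega>'"
  "apart L t \<omega> (restrict \<omega>' {0..<Suc t}) = apart L t \<omega> \<omega>'"
  by (simp_all add: apart_def)

text \<open>Such a function factors through pairs of finite histories, which form a countable
  discrete space.\<close>

lemma measurable_pair_walk:
  fixes H :: "(nat \<Rightarrow> int) \<Rightarrow> (nat \<Rightarrow> int) \<Rightarrow> ennreal"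
  assumes "\<And>\<omega> \<omega>'. H \<omega> \<omega>' = H (restrict \<omega> {0..<n}) (restrict \<omega>' {0..<n})"
  shows "(\<lambda>(\<omega>, \<omega>'). H \<omega> \<omega>') \<in> borel_measurable (walk_measure b \<Otimes>\<^sub>M walk_measure b)"
proof -
  let ?E = "extensional {0..<n} :: (nat \<Rightarrow> int) set"
  have cnt: "countable ?E"
    using countable_PiE[of "{0..<n}" "\<lambda>_. UNIV :: int set"] by (simp add: PiE_def)
  have "(\<lambda>p. (restrict (fst p) {0..<n}, restrict (snd p) {0..<n}))
      \<in> measurable (walk_measure b \<Otimes>\<^sub>M walk_measure b) (count_space ?E \<Otimes>\<^sub>M count_space ?E)"
    by (intro measurable_Pair measurable_compose[OF measurable_fst measurable_walk_restrict]
        measurable_compose[OF measurable_snd measurable_walk_restrict])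
  moreover have "case_prod H \<in> borel_measurable (count_space ?E \<Otimes>\<^sub>M count_space ?E)"
    by (simp add: pair_measure_countable cnt)
  ultimately have "(\<lambda>p. case_prod H (restrict (fst p) {0..<n}, restrict (snd p) {0..<n}))
      \<in> borel_measurable (walk_measure b \<Otimes>\<^sub>M walk_measure b)"
    by (rule measurable_compose)
  then show ?thesis using assms by (simp add: case_prod_unfold)
qed

lemma pair_walk_swap:
  fixes H :: "(nat \<Rightarrow> int) \<Rightarrow> (nat \<Rightarrow> int) \<Rightarrow> ennreal"
  assumes "\<And>\<omega> \<omega>'. H \<omega> \<omega>' = H (restrict \<omega> {0..<n}) (restrict \<omega>' {0..<n})"
  shows "(\<integral>\<^sup>+ \<omega>. \<integral>\<^sup>+ \<omega>'. H \<omega> \<omega>' \<partial>walk_measure b \<partial>walk_measure b) =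
    (\<integral>\<^sup>+ \<omega>'. \<integral>\<^sup>+ \<omega>. H \<omega> \<omega>' \<partial>walk_measure b \<partial>walk_measure b)"
proof -
  interpret prob_space "walk_measure b" by (rule prob_space_walk_measure)
  interpret pair_sigma_finite "walk_measure b" "walk_measure b" ..
  show ?thesis using Fubini'[OF measurable_pair_walk[of H, OF assms]] by simp
qed

context walk_prob
begin

lemma nn_integral_step_pmf:
  assumes "\<And>k. 0 \<le> g k"
  shows "(\<integral>\<^sup>+ k. ennreal (g k) \<partial>step_pmf b x) = ennreal (step_mean b g x)"
  using assms prob_nonneg[of x] prob_le_1[of x]
  by (simp add: step_pmf_def step_mean_def ennreal_plus ennreal_mult mult.commute)

lemma step_mean_nonneg: "(\<And>k. 0 \<le> g k) \<Longrightarrow> 0 \<le> step_mean b g x"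
  using step_mean_mono[of "\<lambda>_. 0" g x] by simp

text \<open>The Markov property is applied to the inner walk with the outer one fixed; then the
  integrals are exchanged and it is applied to the other walk. The weight \<open>apart L t\<close>
  reads only positions up to \<open>t\<close> and passes through both averages.\<close>

lemma nn_integral_pair_walk_Suc:
  fixes g :: "int \<Rightarrow> int \<Rightarrow> real"
  assumes g: "\<And>k l. 0 \<le> g k l"
  shows "(\<integral>\<^sup>+ \<omega>. \<integral>\<^sup>+ \<omega>'. of_bool (apart L t \<omega> \<omega>') * ennreal (g (\<omega> (Suc t)) (\<omega>' (Suc t)))
      \<partial>walk_measure b \<partial>walk_measure b) =
    (\<integral>\<^sup>+ \<omega>. \<integral>\<^sup>+ \<omega>'. of_bool (apart L t \<omega> \<omega>') *
      ennreal (step_mean b (\<lambda>k. step_mean b (g k) (\<omega>' t)) (\<omega> t)) \<partial>walk_measure b \<partial>walk_measure b)"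
    (is "?lhs = ?rhs")
proof -
  have "?lhs = (\<integral>\<^sup>+ \<omega>. \<integral>\<^sup>+ \<omega>'. of_bool (apart L t \<omega> \<omega>') *
      ennreal (step_mean b (g (\<omega> (Suc t))) (\<omega>' t)) \<partial>walk_measure b \<partial>walk_measure b)"
  proof (rule nn_integral_cong)
    fix \<omega>
    show "(\<integral>\<^sup>+ \<omega>'. of_bool (apart L t \<omega> \<omega>') * ennreal (g (\<omega> (Suc t)) (\<omega>' (Suc t))) \<partial>walk_measure b) =
        (\<integral>\<^sup>+ \<omega>'. of_bool (apart L t \<omega> \<omega>') * ennreal (step_mean b (g (\<omega> (Suc t))) (\<omega>' t)) \<partial>walk_measure b)"
      using nn_integral_walk_Suc[where n = t and F = "\<lambda>\<omega>' k. of_bool (apart L t \<omega> \<omega>') * ennreal (g (\<omega> (Suc t)) k)"] g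
      by (simp add: nn_integral_cmult nn_integral_step_pmf)
  qed
  also have "\<dots> = (\<integral>\<^sup>+ \<omega>'. \<integral>\<^sup>+ \<omega>. of_bool (apart L t \<omega> \<omega>') *
      ennreal (step_mean b (g (\<omega> (Suc t))) (\<omega>' t)) \<partial>walk_measure b \<partial>walk_measure b)"
    by (rule pair_walk_swap[of _ "Suc (Suc t)"]) (simp add: apart_def)
  also have "\<dots> = (\<integral>\<^sup>+ \<omega>'. \<integral>\<^sup>+ \<omega>. of_bool (apart L t \<omega> \<omega>') *
      ennreal (step_mean b (\<lambda>k. step_mean b (g k) (\<omega>' t)) (\<omega> t)) \<partial>walk_measure b \<partial>walk_measure b)"
  proof (rule nn_integral_cong)
    fix \<omega>'
    show "(\<integral>\<^sup>+ \<omega>. of_bool (apart L t \<omega> \<omega>') * ennreal (step_mean b (g (\<omega> (Suc t))) (\<omega>' t)) \<partial>walk_measure b) =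
        (\<integral>\<^sup>+ \<omega>. of_bool (apart L t \<omega> \<omega>') *
          ennreal (step_mean b (\<lambda>k. step_mean b (g k) (\<omega>' t)) (\<omega> t)) \<partial>walk_measure b)"
      using nn_integral_walk_Suc[where n = t and F = "\<lambda>\<omega> k. of_bool (apart L t \<omega> \<omega>') * ennreal (step_mean b (g k) (\<omega>' t))"] g
      by (simp add: nn_integral_cmult nn_integral_step_pmf step_mean_nonneg)
  qed
  also have "\<dots> = ?rhs"
    by (rule pair_walk_swap[of _ "Suc (Suc t)", symmetric]) (simp add: apart_def)
  finally show ?thesis .
qed

text \<open>With \<open>T\<close> the first time that the difference is at least \<open>L\<close>,
  both sides are the integral of \<open>min (T - t) n\<close> over the event \<open>T > t\<close>.
  The start \<open>t\<close> stays general because the induction step moves it to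
  \<open>Suc t\<close>.\<close>

lemma sum_apart_eq:
  "(\<Sum>s<n. \<integral>\<^sup>+ \<omega>. \<integral>\<^sup>+ \<omega>'. of_bool (apart L (t + s) \<omega> \<omega>') \<partial>walk_measure b \<partial>walk_measure b) =
    (\<integral>\<^sup>+ \<omega>. \<integral>\<^sup>+ \<omega>'. of_bool (apart L t \<omega> \<omega>') * ennreal (truncated_mean b L n (\<omega> t) (\<omega>' t))
      \<partial>walk_measure b \<partial>walk_measure b)"
proof (induction n arbitrary: t)
  case 0
  show ?case by simp
next
  case (Suc n)
  let ?W = "walk_measure b"
  let ?g = "\<lambda>x y. step_mean b (\<lambda>k. step_mean b (truncated_mean b L n k) y) x"
  note fst = sigma_finite_measure.nn_integral_fst[OF
      prob_space_imp_sigma_finite[OF prob_space_walk_measure]]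
  have g_nonneg: "0 \<le> ?g x y" for x y
    by (intro step_mean_nonneg truncated_mean_nonneg)
  have meas: "(\<lambda>(\<omega>, \<omega>'). of_bool (apart L t \<omega> \<omega>') * ennreal (G (\<omega> t) (\<omega>' t))) \<in> borel_measurable (?W \<Otimes>\<^sub>M ?W)" for G
    by (rule measurable_pair_walk[of _ "Suc t"]) (simp add: apart_def)
  have add: "(\<integral>\<^sup>+ \<omega>. \<integral>\<^sup>+ \<omega>'. F \<omega> \<omega>' \<partial>?W \<partial>?W) + (\<integral>\<^sup>+ \<omega>. \<integral>\<^sup>+ \<omega>'. G \<omega> \<omega>' \<partial>?W \<partial>?W) =
      (\<integral>\<^sup>+ \<omega>. \<integral>\<^sup>+ \<omega>'. F \<omega> \<omega>' + G \<omega> \<omega>' \<partial>?W \<partial>?W)"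
    if "case_prod F \<in> borel_measurable (?W \<Otimes>\<^sub>M ?W)" "case_prod G \<in> borel_measurable (?W \<Otimes>\<^sub>M ?W)" for F G
    using fst[OF that(1)] fst[OF that(2)] fst[OF borel_measurable_add[OF that]] nn_integral_add[OF that]
    by simp
  have "(\<Sum>s<Suc n. \<integral>\<^sup>+ \<omega>. \<integral>\<^sup>+ \<omega>'. of_bool (apart L (t + s) \<omega> \<omega>') \<partial>?W \<partial>?W) =
      (\<integral>\<^sup>+ \<omega>. \<integral>\<^sup>+ \<omega>'. of_bool (apart L t \<omega> \<omega>') \<partial>?W \<partial>?W) +
      (\<integral>\<^sup>+ \<omega>. \<integral>\<^sup>+ \<omega>'. of_bool (apart L (Suc t) \<omega> \<omega>') *
        ennreal (truncated_mean b L n (\<omega> (Suc t)) (\<omega>' (Suc t))) \<partial>?W \<partial>?W)"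
    using Suc[of "Suc t"] by (subst sum.lessThan_Suc_shift) simp
  \<comment> \<open>\<open>truncated_mean\<close> vanishes where the difference has reached
    \<open>L\<close>, so the condition at time \<open>Suc t\<close> may be dropped. The remaining
    weight depends only on the past, as the Markov step requires.\<close>
  also have "(\<integral>\<^sup>+ \<omega>. \<integral>\<^sup>+ \<omega>'. of_bool (apart L (Suc t) \<omega> \<omega>') *
        ennreal (truncated_mean b L n (\<omega> (Suc t)) (\<omega>' (Suc t))) \<partial>?W \<partial>?W) =
      (\<integral>\<^sup>+ \<omega>. \<integral>\<^sup>+ \<omega>'. of_bool (apart L t \<omega> \<omega>') *
        ennreal (truncated_mean b L n (\<omega> (Suc t)) (\<omega>' (Suc t))) \<partial>?W \<partial>?W)"
  proof (intro nn_integral_cong)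
    have "truncated_mean b L n x y = 0" if "L \<le> x - y" for x y
      using that by (cases n) (auto simp: truncated_mean.simps(2))
    then show "of_bool (apart L (Suc t) \<omega> \<omega>') * ennreal (truncated_mean b L n (\<omega> (Suc t)) (\<omega>' (Suc t))) =
        of_bool (apart L t \<omega> \<omega>') * ennreal (truncated_mean b L n (\<omega> (Suc t)) (\<omega>' (Suc t)))" for \<omega> \<omega>'
      by (cases "\<omega> (Suc t) - \<omega>' (Suc t) < L") (auto simp: apart_def le_Suc_eq)
  qed
  also have "\<dots> = (\<integral>\<^sup>+ \<omega>. \<integral>\<^sup>+ \<omega>'. of_bool (apart L t \<omega> \<omega>') * ennreal (?g (\<omega> t) (\<omega>' t)) \<partial>?W \<partial>?W)"
    by (rule nn_integral_pair_walk_Suc) (rule truncated_mean_nonneg)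
  also have "(\<integral>\<^sup>+ \<omega>. \<integral>\<^sup>+ \<omega>'. of_bool (apart L t \<omega> \<omega>') \<partial>?W \<partial>?W) + \<dots> =
      (\<integral>\<^sup>+ \<omega>. \<integral>\<^sup>+ \<omega>'. of_bool (apart L t \<omega> \<omega>') +
        of_bool (apart L t \<omega> \<omega>') * ennreal (?g (\<omega> t) (\<omega>' t)) \<partial>?W \<partial>?W)"
    by (rule add) (use meas[of "\<lambda>_ _. 1"] meas[of ?g] in simp_all)
  also have "\<dots> = (\<integral>\<^sup>+ \<omega>. \<integral>\<^sup>+ \<omega>'. of_bool (apart L t \<omega> \<omega>') *
      ennreal (truncated_mean b L (Suc n) (\<omega> t) (\<omega>' t)) \<partial>?W \<partial>?W)"
    using g_nonneg by (intro nn_integral_cong) (auto simp: apart_def ennreal_plus truncated_mean.simps(2))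
  finally show ?case .
qed

end

section \<open>From first passage to rendezvous\<close>

lemma first_passage_exact:
  fixes z :: "nat \<Rightarrow> int"
  assumes "z 0 < L" "even (L - z 0)" "\<And>n. z (Suc n) - z n \<in> {-2, 0, 2}" "\<And>s. s \<le> t \<Longrightarrow> z s \<noteq> L"
  shows "z t < L"
proof -
  \<comment> \<open>Parity strengthens the induction: an even positive gap is at least 2, so a step
    of at most 2 cannot jump over \<open>L\<close>.\<close>
  have "z t < L \<and> even (L - z t)" using assms(4)
  proof (induction t)
    case 0 then show ?case using assms by simp
  next
    case (Suc t)
    then have "z t < L" "even (L - z t)" by auto
    moreover have "z (Suc t) \<noteq> L" using Suc by simp
    ultimately show ?case using assms(3)[of t] by auto presburger+
  qed
  then show ?thesis ..
qed

lemma less_rendezvous_time_iff: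
  "enat t < rendezvous_time d (\<omega>, \<omega>') \<longleftrightarrow> (\<forall>s\<le>t. \<omega> s \<noteq> \<omega>' s + 2 * int d)"
proof -
  have "rendezvous_time d (\<omega>, \<omega>') \<le> enat t \<longleftrightarrow> (\<exists>s\<le>t. \<omega> s = \<omega>' s + 2 * int d)"
  proof
    assume le: "rendezvous_time d (\<omega>, \<omega>') \<le> enat t"
    let ?S = "{enat t | t. \<omega> t = \<omega>' t + 2 * int d}"
    from le have "?S \<noteq> {}" by (auto simp: rendezvous_time_def Inf_enat_def split: if_splits)
    then have "Inf ?S \<in> ?S" by (auto simp: Inf_enat_def intro: LeastI)
    with le show "\<exists>s\<le>t. \<omega> s = \<omega>' s + 2 * int d" by (auto simp: rendezvous_time_def)
  next
    assume "\<exists>s\<le>t. \<omega> s = \<omega>' s + 2 * int d"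
    then obtain s where "s \<le> t" "\<omega> s = \<omega>' s + 2 * int d" by blast
    then have "rendezvous_time d (\<omega>, \<omega>') \<le> enat s" unfolding rendezvous_time_def by (auto intro: Inf_lower)
    with \<open>s \<le> t\<close> show "rendezvous_time d (\<omega>, \<omega>') \<le> enat t" by (meson enat_ord_simps(1) order_trans)
  qed
  then show ?thesis by (auto simp: not_le[symmetric])
qed

context walk_prob
begin

text \<open>Almost surely both paths make unit steps from 0, so their difference is even, starts
  below \<open>2 * d\<close> and changes by at most 2. Not having met then means not having passed
  \<open>2 * d\<close>.\<close>

lemma emeasure_less_rendezvous_time_le:
  assumes "d \<ge> 1"
  shows "emeasure (walk_measure b \<Otimes>\<^sub>M walk_measure b)
      {p \<in> space (walk_measure b \<Otimes>\<^sub>M walk_measure b). enat t < rendezvous_time d p} \<le>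
    (\<integral>\<^sup>+ \<omega>. \<integral>\<^sup>+ \<omega>'. of_bool (apart (2 * int d) t \<omega> \<omega>') \<partial>walk_measure b \<partial>walk_measure b)"
proof -
  let ?W = "walk_measure b"
  interpret prob_space ?W by (rule prob_space_walk_measure)
  have [measurable]: "{p \<in> space (?W \<Otimes>\<^sub>M ?W). enat t < rendezvous_time d p} \<in> sets (?W \<Otimes>\<^sub>M ?W)"
    by measurable
  let ?nn = "\<lambda>\<omega>::nat \<Rightarrow> int. \<omega> 0 = 0 \<and> (\<forall>n. \<bar>\<omega> (Suc n) - \<omega> n\<bar> = 1)"
  have apart: "apart (2 * int d) t \<omega> \<omega>'"
    if "?nn \<omega>" "?nn \<omega>'" "enat t < rendezvous_time d (\<omega>, \<omega>')" for \<omega> \<omega>'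
    unfolding apart_def
  proof (intro allI impI)
    fix s assume "s \<le> t"
    show "\<omega> s - \<omega>' s < 2 * int d"
    proof (rule first_passage_exact[of "\<lambda>s. \<omega> s - \<omega>' s"])
      show "\<omega> (Suc n) - \<omega>' (Suc n) - (\<omega> n - \<omega>' n) \<in> {- 2, 0, 2}" for n
        using that(1)[THEN conjunct2, rule_format, of n] that(2)[THEN conjunct2, rule_format, of n]
        by (auto simp: abs_if split: if_splits)
      show "\<omega> r - \<omega>' r \<noteq> 2 * int d" if "r \<le> s" for r
      proof -
        have "\<omega> r \<noteq> \<omega>' r + 2 * int d"
          using \<open>enat t < _\<close> \<open>s \<le> t\<close> \<open>r \<le> s\<close> less_rendezvous_time_iff[of t d \<omega> \<omega>'] by simp
        then show ?thesis by linarith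
      qed
    qed (use that assms in auto)
  qed
  have "emeasure (?W \<Otimes>\<^sub>M ?W) {p \<in> space (?W \<Otimes>\<^sub>M ?W). enat t < rendezvous_time d p} =
      (\<integral>\<^sup>+ \<omega>. \<integral>\<^sup>+ \<omega>'. indicator {p \<in> space (?W \<Otimes>\<^sub>M ?W). enat t < rendezvous_time d p} (\<omega>, \<omega>') \<partial>?W \<partial>?W)"
    by (rule emeasure_pair_measure) measurable
  also have "\<dots> \<le> (\<integral>\<^sup>+ \<omega>. \<integral>\<^sup>+ \<omega>'. of_bool (apart (2 * int d) t \<omega> \<omega>') \<partial>?W \<partial>?W)"
  proof (rule nn_integral_mono_AE)
    show "AE \<omega> in ?W. (\<integral>\<^sup>+ \<omega>'. indicator {p \<in> space (?W \<Otimes>\<^sub>M ?W). enat t < rendezvous_time d p} (\<omega>, \<omega>') \<partial>?W)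
        \<le> (\<integral>\<^sup>+ \<omega>'. of_bool (apart (2 * int d) t \<omega> \<omega>') \<partial>?W)"
      using AE_walk_nearest_neighbour
    proof eventually_elim
      case (elim \<omega>)
      show ?case
      proof (rule nn_integral_mono_AE)
        show "AE \<omega>' in ?W. indicator {p \<in> space (?W \<Otimes>\<^sub>M ?W). enat t < rendezvous_time d p} (\<omega>, \<omega>')
            \<le> (of_bool (apart (2 * int d) t \<omega> \<omega>') :: ennreal)"
          using AE_walk_nearest_neighbour
        proof eventually_elim
          case (elim \<omega>')
          with \<open>?nn \<omega>\<close> show ?case by (auto simp: apart split: split_indicator)
        qed
      qed
    qed
  qed
  finally show ?thesis .
qed

text \<open>The mean is the sum of the tail probabilities. Its partial sums are controlled by
  truncated means at time 0, when both walks are almost surely at the origin.\<close>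

lemma nn_integral_rendezvous_time_le:
  assumes d: "d \<ge> 1" and le: "\<And>n. truncated_mean b (2 * int d) n 0 0 \<le> K"
  shows "(\<integral>\<^sup>+ p. ennreal_of_enat (rendezvous_time d p) \<partial>(walk_measure b \<Otimes>\<^sub>M walk_measure b)) \<le> ennreal K"
proof -
  let ?W = "walk_measure b"
  let ?P = "\<lambda>t. emeasure (?W \<Otimes>\<^sub>M ?W) {p \<in> space (?W \<Otimes>\<^sub>M ?W). enat t < rendezvous_time d p}"
  interpret prob_space ?W by (rule prob_space_walk_measure)
  have "(\<integral>\<^sup>+ p. ennreal_of_enat (rendezvous_time d p) \<partial>(?W \<Otimes>\<^sub>M ?W)) = (\<Sum>t. ?P t)"
    by (rule nn_integral_enat_function) measurable
  also have "\<dots> = (SUP n. \<Sum>t<n. ?P t)" by (rule suminf_eq_SUP)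
  also have "\<dots> \<le> ennreal K"
  proof (rule SUP_least)
    fix n
    have "(\<Sum>t<n. ?P t) \<le>
        (\<Sum>t<n. \<integral>\<^sup>+ \<omega>. \<integral>\<^sup>+ \<omega>'. of_bool (apart (2 * int d) (0 + t) \<omega> \<omega>') \<partial>?W \<partial>?W)"
      by (intro sum_mono) (use emeasure_less_rendezvous_time_le[OF d] in simp)
    also have "\<dots> = (\<integral>\<^sup>+ \<omega>. \<integral>\<^sup>+ \<omega>'. of_bool (apart (2 * int d) 0 \<omega> \<omega>') *
        ennreal (truncated_mean b (2 * int d) n (\<omega> 0) (\<omega>' 0)) \<partial>?W \<partial>?W)"
      by (rule sum_apart_eq)
    also have "\<dots> \<le> (\<integral>\<^sup>+ \<omega>. ennreal K \<partial>?W)"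
    proof (rule nn_integral_mono_AE)
      show "AE \<omega> in ?W. (\<integral>\<^sup>+ \<omega>'. of_bool (apart (2 * int d) 0 \<omega> \<omega>') *
          ennreal (truncated_mean b (2 * int d) n (\<omega> 0) (\<omega>' 0)) \<partial>?W) \<le> ennreal K"
        using AE_walk_nearest_neighbour
      proof eventually_elim
        case (elim \<omega>)
        have "(\<integral>\<^sup>+ \<omega>'. of_bool (apart (2 * int d) 0 \<omega> \<omega>') *
            ennreal (truncated_mean b (2 * int d) n (\<omega> 0) (\<omega>' 0)) \<partial>?W) \<le> (\<integral>\<^sup>+ \<omega>'. ennreal K \<partial>?W)"
          by (rule nn_integral_mono_AE, use AE_walk_nearest_neighbour in eventually_elim)
            (use elim le[of n] in \<open>auto intro!: ennreal_leI\<close>)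
        then show ?case by (simp add: emeasure_space_1[simplified])
      qed
    qed
    also have "\<dots> = ennreal K" by (simp add: emeasure_space_1[simplified])
    finally show "(\<Sum>t<n. ?P t) \<le> ennreal K" .
  qed
  finally show ?thesis .
qed

end

section \<open>A strategy with polynomial return times\<close>

text \<open>Solving \<open>a k * D k = 1 + (1 - a k) * D (k - 1)\<close> for \<open>a k\<close> gives the strategy for which \<open>D k\<close> is the
  expected time to pass from distance \<open>k\<close> to \<open>k + 1\<close>.\<close>

definition passage_increment :: "real \<Rightarrow> nat \<Rightarrow> real" where
  "passage_increment \<epsilon> k = (if k = 0 then 1 else 64 / \<epsilon> * real k powr (1 + \<epsilon>))"

definition strategy :: "real \<Rightarrow> nat \<Rightarrow> real" where
  "strategy \<epsilon> k = (if k = 0 then 1 / 2 else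
     (1 + passage_increment \<epsilon> (k - 1)) / (passage_increment \<epsilon> k + passage_increment \<epsilon> (k - 1)))"

definition passage_time :: "real \<Rightarrow> int \<Rightarrow> real" where
  "passage_time \<epsilon> x = (\<Sum>k<nat \<bar>x\<bar>. passage_increment \<epsilon> k)"

text \<open>The potential \<open>x\<^sup>2\<close> is lowered away from 0 so that its positive drift at 0 is smaller than its
  negative drift at the even states.\<close>

definition return_potential :: "real \<Rightarrow> int \<Rightarrow> real" where
  "return_potential \<epsilon> x = (if x = 0 then 0 else (real_of_int x)\<^sup>2 - 1 + \<epsilon> / 4)"

text \<open>Bernoulli's inequality; at \<open>x = 1 / (k - 1)\<close> it bounds the relative growth
  of \<open>k powr (1 + \<epsilon>)\<close> from below.\<close>

lemma powr_ge_one_plus: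
  fixes x s :: real
  assumes "0 \<le> x" "1 \<le> s"
  shows "1 + s * x \<le> (1 + x) powr s"
proof -
  have pos: "0 < 1 + s * x" using assms mult_nonneg_nonneg[of s x] by linarith
  \<comment> \<open>Young's inequality with weights \<open>1 / s\<close> and \<open>1 - 1 / s\<close>\<close>
  have "(1 + s * x) powr (1 / s) * 1 powr (1 - 1 / s) \<le> 1 / s * (1 + s * x) + (1 - 1 / s) * 1"
    using assms pos by (intro Youngs_inequality_0) auto
  also have "\<dots> = 1 + x" using assms by (simp add: field_simps)
  finally have "((1 + s * x) powr (1 / s)) powr s \<le> (1 + x) powr s"
    using assms by (intro powr_mono2) auto
  with pos show ?thesis using assms by (simp add: powr_powr)
qed

lemma signed_extension_reflect:
  assumes "a 0 = 1 / 2"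
  shows "signed_extension a (- x) = 1 - signed_extension a x"
  using assms by (auto simp: signed_extension_def)

text \<open>An even \<open>g\<close> sees only the distance from 0, which grows with probability
  \<open>a\<close> on either side.\<close>

lemma step_mean_even:
  assumes "a 0 = 1 / 2" "\<And>x. g (- x) = g x"
  shows "step_mean (signed_extension a) g x =
    (if x = 0 then g 1 else a (nat \<bar>x\<bar>) * g (\<bar>x\<bar> + 1) + (1 - a (nat \<bar>x\<bar>)) * g (\<bar>x\<bar> - 1))"
proof -
  have *: "g (-1) = g 1" "g (- x - 1) = g (x + 1)" "g (1 - x) = g (x - 1)"
    using assms(2)[of 1] assms(2)[of "x + 1"] assms(2)[of "x - 1"] by simp_all
  show ?thesis
    using assms(1) * by (auto simp: step_mean_def signed_extension_def abs_if algebra_simps)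
qed

context
  fixes \<epsilon> :: real
  assumes eps: "0 < \<epsilon>" "\<epsilon> \<le> 1"
begin

text \<open>This makes the numerator of \<open>strategy\<close> at most its denominator, so that its
  values are probabilities.\<close>

lemma passage_increment_ge_1: "1 \<le> passage_increment \<epsilon> k"
proof (cases "k = 0")
  case False
  have "1 \<le> 64 / \<epsilon>" using eps by simp
  moreover have "1 \<le> real k powr (1 + \<epsilon>)" using False eps by (intro ge_one_powr_ge_zero) auto
  ultimately have "1 * 1 \<le> 64 / \<epsilon> * real k powr (1 + \<epsilon>)" using eps by (intro mult_mono) auto
  with False show ?thesis by (simp add: passage_increment_def)
qed (simp add: passage_increment_def)

lemma admissible_strategy: "admissible (strategy \<epsilon>)"
proof -
  have "0 \<le> strategy \<epsilon> k \<and> strategy \<epsilon> k \<le> 1" for k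
    using passage_increment_ge_1[of k] passage_increment_ge_1[of "k - 1"]
    by (simp add: strategy_def)
  then show ?thesis by (simp add: admissible_def strategy_def)
qed

lemma strategy_passage:
  assumes "1 \<le> k"
  shows "strategy \<epsilon> k * passage_increment \<epsilon> k =
    1 + (1 - strategy \<epsilon> k) * passage_increment \<epsilon> (k - 1)"
proof -
  have "passage_increment \<epsilon> k + passage_increment \<epsilon> (k - 1) > 0"
    using passage_increment_ge_1[of k] passage_increment_ge_1[of "k - 1"] by linarith
  then show ?thesis using assms by (simp add: strategy_def field_simps)
qed

text \<open>By \<open>strategy_passage\<close>, the mean gain from moving outwards exceeds the mean
  loss from moving inwards by exactly 1. At 0 every move is outwards, and the increment there is
  1.\<close>

lemma passage_time_drift:
  "step_mean (signed_extension (strategy \<epsilon>)) (passage_time \<epsilon>) x = passage_time \<epsilon> x + 1"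
proof -
  have *: "step_mean (signed_extension (strategy \<epsilon>)) (passage_time \<epsilon>) x =
      (if x = 0 then passage_time \<epsilon> 1 else
        strategy \<epsilon> (nat \<bar>x\<bar>) * passage_time \<epsilon> (\<bar>x\<bar> + 1) +
        (1 - strategy \<epsilon> (nat \<bar>x\<bar>)) * passage_time \<epsilon> (\<bar>x\<bar> - 1))"
    by (rule step_mean_even) (simp_all add: strategy_def passage_time_def)
  show ?thesis
  proof (cases "x = 0")
    case True
    then show ?thesis unfolding * by (simp add: passage_time_def passage_increment_def)
  next
    case False
    define j where "j = nat \<bar>x\<bar> - 1"
    with False have x: "nat \<bar>x\<bar> = Suc j" by simp
    then have x': "\<bar>x\<bar> = int (Suc j)" by simp
    have up: "passage_time \<epsilon> (\<bar>x\<bar> + 1) = passage_time \<epsilon> x + passage_increment \<epsilon> (Suc j)"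
      and down: "passage_time \<epsilon> (\<bar>x\<bar> - 1) = passage_time \<epsilon> x - passage_increment \<epsilon> j"
      using x by (simp_all add: passage_time_def x' nat_add_distrib)
    show ?thesis
      using strategy_passage[of "Suc j"] False
      unfolding * up down x by (simp add: algebra_simps)
  qed
qed

section \<open>Drift of the return potential\<close>

lemma strategy_one_le: "strategy \<epsilon> 1 \<le> \<epsilon> / 32"
proof -
  have "strategy \<epsilon> 1 = 2 / (64 / \<epsilon> + 1)"
    by (simp add: strategy_def passage_increment_def)
  also have "\<dots> \<le> 2 / (64 / \<epsilon>)" using eps by (intro divide_left_mono mult_pos_pos add_pos_pos) auto
  finally show ?thesis by simp
qed

text \<open>The left side plus 1 is the drift of the squared distance at \<open>k\<close>. The
  growth of the increments contributes \<open>- (1 + \<epsilon>)\<close>, and the summand 1 in the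
  numerator of \<open>strategy\<close> costs at most \<open>\<epsilon> / 2\<close>.\<close>

lemma strategy_drift_le:
  assumes k: "2 \<le> k"
  shows "2 * real k * (2 * strategy \<epsilon> k - 1) \<le> - 1 - \<epsilon> / 2"
proof -
  define p where "p = real k powr (1 + \<epsilon>)"
  define q where "q = real (k - 1) powr (1 + \<epsilon>)"
  have q: "1 \<le> q" unfolding q_def using k eps by (intro ge_one_powr_ge_zero) auto
  have pk: "real k \<le> p" unfolding p_def using powr_mono[of 1 "1 + \<epsilon>" "real k"] k eps by simp
  have ratio: "(1 + (1 + \<epsilon>) / real (k - 1)) * q \<le> p"
  proof -
    have "1 + (1 + \<epsilon>) * (1 / real (k - 1)) \<le> (1 + 1 / real (k - 1)) powr (1 + \<epsilon>)"
      using k eps by (intro powr_ge_one_plus) auto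
    also have "1 + 1 / real (k - 1) = real k / real (k - 1)"
      using k by (simp add: field_simps of_nat_diff)
    also have "\<dots> powr (1 + \<epsilon>) = p / q"
      unfolding p_def q_def by (rule powr_divide)
    finally have "1 + (1 + \<epsilon>) / real (k - 1) \<le> p / q" by simp
    then show ?thesis using q by (simp add: pos_le_divide_eq)
  qed
  \<comment> \<open>Twice the bound \<open>(1 + \<epsilon>) * q \<le> (p - q) * (k - 1)\<close> is
    added to \<open>(1 + \<epsilon>) * (p - q) \<le> 2 * (p - q)\<close>, which uses
    \<open>\<epsilon> \<le> 1\<close>.\<close>
  have lin: "(1 + \<epsilon>) * (p + q) \<le> 2 * real k * (p - q)"
  proof -
    have "(1 + \<epsilon>) * q \<le> (p - q) * (real k - 1)"
      using ratio k by (simp add: field_simps of_nat_diff)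
    then have "2 * (1 + \<epsilon>) * q \<le> (p - q) * (2 * real k - 2)" by (simp add: algebra_simps)
    moreover have "(1 + \<epsilon>) * (p - q) \<le> 2 * (p - q)"
    proof (rule mult_right_mono)
      have "q \<le> p" unfolding p_def q_def using k eps by (intro powr_mono2) auto
      then show "0 \<le> p - q" by simp
    qed (use eps in simp)
    ultimately show ?thesis by (simp add: algebra_simps)
  qed
  have A: "strategy \<epsilon> k = (1 + 64 / \<epsilon> * q) / (64 / \<epsilon> * p + 64 / \<epsilon> * q)"
    using k by (simp add: strategy_def passage_increment_def p_def q_def)
  have "2 * strategy \<epsilon> k - 1 = (\<epsilon> / 32 - (p - q)) / (p + q)"
  proof -
    have "strategy \<epsilon> k = (\<epsilon> / 64 + q) / (p + q)"
    proof -
      have "strategy \<epsilon> k = (64 / \<epsilon> * (\<epsilon> / 64 + q)) / (64 / \<epsilon> * (p + q))"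
        unfolding A distrib_left using eps by simp
      also have "\<dots> = (\<epsilon> / 64 + q) / (p + q)" using eps by (intro mult_divide_mult_cancel_left) auto
      finally show ?thesis .
    qed
    then show ?thesis using q pk by (simp add: field_simps)
  qed
  then have "2 * real k * (2 * strategy \<epsilon> k - 1) = (real k * \<epsilon> / 16 - 2 * real k * (p - q)) / (p + q)"
    by (simp add: algebra_simps)
  also have "\<dots> \<le> (- 1 - \<epsilon> / 2) * (p + q) / (p + q)"
  proof (rule divide_right_mono)
    have "real k * \<epsilon> / 16 \<le> \<epsilon> / 2 * (p + q)"
    proof -
      have "\<epsilon> / 16 * real k \<le> \<epsilon> / 2 * (p + q)" using pk q eps by (intro mult_mono) auto
      then show ?thesis by (simp add: mult.commute)
    qed
    moreover have "(- 1 - \<epsilon> / 2) * (p + q) = \<epsilon> / 2 * (p + q) - (1 + \<epsilon>) * (p + q)"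
      by (simp add: field_simps)
    ultimately show "real k * \<epsilon> / 16 - 2 * real k * (p - q) \<le> (- 1 - \<epsilon> / 2) * (p + q)"
      using lin by linarith
  qed (use pk q in simp)
  also have "\<dots> = - 1 - \<epsilon> / 2" using pk q by simp
  finally show ?thesis .
qed

lemma return_potential_drift:
  "step_mean (signed_extension (strategy \<epsilon>)) (return_potential \<epsilon>) x \<le>
    return_potential \<epsilon> x + (if x = 0 then \<epsilon> / 4 else if \<bar>x\<bar> = 1 then - \<epsilon> / 8 else - \<epsilon> / 2)"
proof -
  have *: "step_mean (signed_extension (strategy \<epsilon>)) (return_potential \<epsilon>) x =
      (if x = 0 then return_potential \<epsilon> 1 else
        strategy \<epsilon> (nat \<bar>x\<bar>) * return_potential \<epsilon> (\<bar>x\<bar> + 1) +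
        (1 - strategy \<epsilon> (nat \<bar>x\<bar>)) * return_potential \<epsilon> (\<bar>x\<bar> - 1))"
    by (rule step_mean_even) (simp_all add: strategy_def return_potential_def)
  consider "x = 0" | "\<bar>x\<bar> = 1" | "2 \<le> \<bar>x\<bar>" by linarith
  then show ?thesis
  proof cases
    case 1
    then show ?thesis unfolding * by (simp add: return_potential_def)
  next
    case 2
    \<comment> \<open>From distance 1 the potential falls from \<open>\<epsilon> / 4\<close> to 0
      unless the walk moves outwards, to potential \<open>3 + \<epsilon> / 4\<close>. The factor
      \<open>64 / \<epsilon>\<close> in the increments keeps the mean cost of that below
      \<open>\<epsilon> / 8\<close>.\<close>
    have "strategy \<epsilon> 1 * (3 + \<epsilon> / 4) \<le> \<epsilon> / 32 * 4"
      using strategy_one_le eps by (intro mult_mono) auto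
    moreover have "(real_of_int x)\<^sup>2 = 1" using 2 by (auto simp: abs_if split: if_splits)
    moreover have "x \<noteq> 0" using 2 by auto
    ultimately show ?thesis using 2 by (simp add: * return_potential_def algebra_simps)
  next
    case 3
    define k where "k = nat \<bar>x\<bar>"
    have k: "2 \<le> k" "\<bar>x\<bar> = int k" "real_of_int x ^ 2 = real k ^ 2"
      using 3 by (auto simp: k_def)
    have "x \<noteq> 0" "\<bar>x\<bar> \<noteq> 1" using 3 by auto
    \<comment> \<open>Both neighbours lie at distance at least 1, where the potential is the square
      plus a fixed offset; the offset cancels in the drift.\<close>
    have "step_mean (signed_extension (strategy \<epsilon>)) (return_potential \<epsilon>) x =
        strategy \<epsilon> k * ((real k + 1)\<^sup>2 - 1 + \<epsilon> / 4) + (1 - strategy \<epsilon> k) * ((real k - 1)\<^sup>2 - 1 + \<epsilon> / 4)"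
      using \<open>x \<noteq> 0\<close> k by (simp add: * return_potential_def)
    also have "\<dots> = return_potential \<epsilon> x + 1 + 2 * real k * (2 * strategy \<epsilon> k - 1)"
      using \<open>x \<noteq> 0\<close> k(3) by (simp add: return_potential_def power2_eq_square field_simps)
    finally show ?thesis
      using strategy_drift_le[OF k(1)] \<open>x \<noteq> 0\<close> \<open>\<bar>x\<bar> \<noteq> 1\<close> by simp
  qed
qed

lemma strategy_lyapunov:
  "symmetric_walk_lyapunov (signed_extension (strategy \<epsilon>)) (passage_time \<epsilon>) (return_potential \<epsilon>) (\<epsilon> / 8)"
proof
  let ?b = "signed_extension (strategy \<epsilon>)"
  show "0 \<le> ?b x" "?b x \<le> 1" for x
    using admissible_strategy by (simp_all add: signed_extension_def admissible_def)
  show "?b (- x) = 1 - ?b x" for x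
    by (rule signed_extension_reflect) (simp add: strategy_def)
  show "0 \<le> return_potential \<epsilon> x" for x
  proof (cases "x = 0")
    case False
    then have "1 \<le> (real_of_int x)\<^sup>2"
      using one_le_power[of "\<bar>real_of_int x\<bar>" 2] by auto
    then show ?thesis using eps by (simp add: return_potential_def)
  qed (simp add: return_potential_def)
  show "step_mean ?b (return_potential \<epsilon>) x + step_mean ?b (return_potential \<epsilon>) y
      \<le> return_potential \<epsilon> x + return_potential \<epsilon> y - \<epsilon> / 8"
    if "even (x + y)" "(x, y) \<noteq> (0, 0)" for x y
  proof -
    \<comment> \<open>Parity rules out 0 paired with \<open>\<plusminus>1\<close>, where the drift
      bounds add up to a positive number. All remaining pairs have total drift at most
      \<open>- \<epsilon> / 4\<close>.\<close>
    have "\<not> (x = 0 \<and> \<bar>y\<bar> = 1)" "\<not> (y = 0 \<and> \<bar>x\<bar> = 1)" using that(1) by (auto simp: abs_if split: if_splits)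
    with that(2) return_potential_drift[of x] return_potential_drift[of y] eps
    show ?thesis by (auto split: if_splits)
  qed
qed (use eps passage_time_drift in \<open>auto simp: passage_time_def return_potential_def\<close>)

lemma expected_rendezvous_time_strategy_le:
  assumes d: "d \<ge> 1"
  shows "expected_rendezvous_time d (strategy \<epsilon>) \<le> ennreal (2240 / \<epsilon> * real d powr (2 + \<epsilon>))"
proof -
  interpret symmetric_walk_lyapunov "signed_extension (strategy \<epsilon>)"
    "passage_time \<epsilon>" "return_potential \<epsilon>" "\<epsilon> / 8"
    by (rule strategy_lyapunov)
  let ?L = "2 * int d" and ?D = "2 * real d"
  have passage_le: "passage_time \<epsilon> x \<le> 64 / \<epsilon> * ?D powr (2 + \<epsilon>)" if "\<bar>x\<bar> \<le> ?L" for x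
  proof -
    have "passage_time \<epsilon> x \<le> (\<Sum>k<nat \<bar>x\<bar>. 64 / \<epsilon> * ?D powr (1 + \<epsilon>))"
      unfolding passage_time_def
    proof (rule sum_mono)
      fix k assume "k \<in> {..<nat \<bar>x\<bar>}"
      then have "real k \<le> ?D" using that by auto
      \<comment> \<open>Covers \<open>k = 0\<close>, where the increment is 1.\<close>
      moreover have "1 \<le> 64 / \<epsilon> * ?D powr (1 + \<epsilon>)"
        using passage_increment_ge_1[of "2 * d"] d by (simp add: passage_increment_def)
      ultimately show "passage_increment \<epsilon> k \<le> 64 / \<epsilon> * ?D powr (1 + \<epsilon>)"
        using eps by (auto simp: passage_increment_def intro!: mult_left_mono divide_right_mono powr_mono2)
    qed
    also have "\<dots> = real (nat \<bar>x\<bar>) * (64 / \<epsilon> * ?D powr (1 + \<epsilon>))" by simp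
    also have "\<dots> \<le> ?D * (64 / \<epsilon> * ?D powr (1 + \<epsilon>))"
      using that eps by (intro mult_right_mono) auto
    also have "\<dots> = 64 / \<epsilon> * (?D powr 1 * ?D powr (1 + \<epsilon>))" using d by simp
    also have "\<dots> = 64 / \<epsilon> * ?D powr (2 + \<epsilon>)" unfolding powr_add[symmetric] by simp
    finally show ?thesis .
  qed
  have return_le: "return_potential \<epsilon> x \<le> ?D\<^sup>2" if "\<bar>x\<bar> \<le> ?L" for x
  proof -
    have "\<bar>real_of_int x\<bar> \<le> ?D" using that by linarith
    then have "\<bar>real_of_int x\<bar>\<^sup>2 \<le> ?D\<^sup>2" by (intro power_mono) auto
    then have "(real_of_int x)\<^sup>2 \<le> ?D\<^sup>2" by (simp only: power2_abs)
    then show ?thesis using eps by (auto simp: return_potential_def)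
  qed
  have bound: "6 * ?D\<^sup>2 / (\<epsilon> / 8) + 4 * (64 / \<epsilon> * ?D powr (2 + \<epsilon>)) \<le> 2240 / \<epsilon> * real d powr (2 + \<epsilon>)"
  proof -
    have "?D powr (2 + \<epsilon>) = 2 powr (2 + \<epsilon>) * real d powr (2 + \<epsilon>)"
      by (simp add: powr_mult)
    also have "\<dots> \<le> 2 powr 3 * real d powr (2 + \<epsilon>)"
      using eps by (intro mult_right_mono powr_mono) auto
    finally have 1: "?D powr (2 + \<epsilon>) \<le> 8 * real d powr (2 + \<epsilon>)" by simp
    have "(real d)\<^sup>2 = real d powr 2" using d by simp
    also have "\<dots> \<le> real d powr (2 + \<epsilon>)" using d eps by (intro powr_mono) auto
    finally have 2: "(real d)\<^sup>2 \<le> real d powr (2 + \<epsilon>)" .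
    have "6 * ?D\<^sup>2 / (\<epsilon> / 8) + 4 * (64 / \<epsilon> * ?D powr (2 + \<epsilon>)) =
        (192 * (real d)\<^sup>2 + 256 * ?D powr (2 + \<epsilon>)) / \<epsilon>"
      by (simp add: power_mult_distrib add_divide_distrib)
    \<comment> \<open>The constant is \<open>192 + 256 * 8\<close>.\<close>
    also have "\<dots> \<le> 2240 * real d powr (2 + \<epsilon>) / \<epsilon>"
      using 1 2 eps by (intro divide_right_mono) auto
    finally show ?thesis by simp
  qed
  have "truncated_mean (signed_extension (strategy \<epsilon>)) ?L n 0 0 \<le> 2240 / \<epsilon> * real d powr (2 + \<epsilon>)" for n
    by (rule order_trans[OF truncated_mean_le[of ?L, OF passage_le return_le] bound]) simp_all
  then show ?thesis
    unfolding expected_rendezvous_time_def Let_def by (rule nn_integral_rendezvous_time_le[OF d])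
qed

end

theorem theorem3:
  fixes \<eta> :: real
  assumes "\<eta> > 0"
  shows "\<exists>a. admissible a \<and>
    (\<exists>C :: real. \<forall>d :: nat. d \<ge> 1 \<longrightarrow>
      expected_rendezvous_time d a \<le> ennreal (C * real d powr (2 + \<eta>)))"
proof -
  \<comment> \<open>For \<open>\<eta> > 1\<close> the strategy with exponent 3 already suffices, as
    \<open>d \<ge> 1\<close>.\<close>
  define \<epsilon> where "\<epsilon> = min \<eta> 1"
  have eps: "0 < \<epsilon>" "\<epsilon> \<le> 1" using assms by (auto simp: \<epsilon>_def)
  have "expected_rendezvous_time d (strategy \<epsilon>) \<le> ennreal (2240 / \<epsilon> * real d powr (2 + \<eta>))"
    if "d \<ge> 1" for d
  proof -
    have "real d powr (2 + \<epsilon>) \<le> real d powr (2 + \<eta>)"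
      using that by (intro powr_mono) (auto simp: \<epsilon>_def)
    then have "2240 / \<epsilon> * real d powr (2 + \<epsilon>) \<le> 2240 / \<epsilon> * real d powr (2 + \<eta>)"
      using eps by (intro mult_left_mono) auto
    then show ?thesis
      using expected_rendezvous_time_strategy_le[OF eps that] by (meson ennreal_leI order_trans)
  qed
  with admissible_strategy[OF eps] show ?thesis by blast
qed

end
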